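(* Let $\varphi:\mathbb{R}^n\to\mathbb{R}$ be a strongly quasiconvex, continuous, nonnegative function with $\varphi(0)=0$, let $C\subseteq\mathbb{R}^n$ be a closed convex cone, and let $P:\mathbb{R}^n\to C$ be the $\varphi$-projection onto $C$, $Px=\operatorname{argmin}\{\varphi(x-y):y\in C\}$. Let $I$ be the identity mapping of $\mathbb{R}^n$. Then $$P(I-P)=0\quad\text{(i.e. } P(x-Px)=0 \text{ for all } x\in\mathbb{R}^n\text{)},\qquad (I-P)(\mathbb{R}^n)=\ker(P):=\{x\in\mathbb{R}^n:P(x)=0\}.$$
   Context: A continuous function $\varphi:\mathbb{R}^n\to\mathbb{R}$ is strongly quasiconvex if $\varphi(\lambda x+(1-\lambda)y)<\max\{\varphi(x),\varphi(y)\}$ for all $\lambda\in(0,1)$ and all $x\neq y$ in $\mathbb{R}^n$. A convex cone is a nonempty set $C\subseteq\mathbb{R}^n$ with $\lambda x\in C$ and $x+y\in C$ for all $x,y\in C$, $\lambda\ge 0$. The $\varphi$-projection $P$ onto $C$ is the mapping sending $x$ to the unique minimizer over $y\in C$ of $\varphi(x-y)$; it is part of the setting that for every $x\in\mathbb{R}^n$ this minimizer exists and is unique, so that $P$ is a well-defined mapping on $\mathbb{R}^n$. *)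

theory Defs
  imports "HOL-Analysis.Analysis"
begin

definition strongly_quasiconvex :: "('a::real_normed_vector \<Rightarrow> real) \<Rightarrow> bool" where
  "strongly_quasiconvex \<phi> \<longleftrightarrow>
     (\<forall>x y. \<forall>t\<in>{0<..<1}. x \<noteq> y \<longrightarrow>
        \<phi> (t *\<^sub>R x + (1 - t) *\<^sub>R y) < max (\<phi> x) (\<phi> y))"

definition has_phi_projection :: "('a::real_vector \<Rightarrow> real) \<Rightarrow> 'a set \<Rightarrow> bool" where
  "has_phi_projection \<phi> C \<longleftrightarrow>
     (\<forall>x. \<exists>!p. is_arg_min (\<lambda>y. \<phi> (x - y)) (\<lambda>y. y \<in> C) p)"

(* Built on Hilbert choice, so only meaningful under has_phi_projection. *)
definition phi_projection :: "('a::real_vector \<Rightarrow> real) \<Rightarrow> 'a set \<Rightarrow> 'a \<Rightarrow> 'a" where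
  "phi_projection \<phi> C x = arg_min_on (\<lambda>y. \<phi> (x - y)) C"

end

theory Submission
  imports Defs
begin

text \<open>
  Everything rests on the closure of the cone under addition: translating a competitor
  \<open>y \<in> C\<close> for the residual \<open>x - P x\<close> by \<open>P x\<close> gives the competitor \<open>P x + y \<in> C\<close> for \<open>x\<close>, with
  the same value \<open>\<phi> (x - P x - y)\<close>. Since \<open>P x\<close> is optimal for \<open>x\<close>, the competitor \<open>0\<close> is optimal
  for the residual, and uniqueness of minimizers gives \<open>P (x - P x) = 0\<close>. So every residual lies
  in the kernel; conversely a point of the kernel is its own residual.
\<close>

lemma phi_projection_eq_iff:
  assumes "has_phi_projection \<phi> C"
  shows "phi_projection \<phi> C x = p \<longleftrightarrow> p \<in> C \<and> (\<forall>y\<in>C. \<phi> (x - p) \<le> \<phi> (x - y))"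
proof -
  have ex1: "\<exists>!p. is_arg_min (\<lambda>y. \<phi> (x - y)) (\<lambda>y. y \<in> C) p"
    using assms unfolding has_phi_projection_def by blast
  then have "is_arg_min (\<lambda>y. \<phi> (x - y)) (\<lambda>y. y \<in> C) (phi_projection \<phi> C x)"
    unfolding phi_projection_def arg_min_on_def arg_min_def by (metis someI_ex)
  then have "phi_projection \<phi> C x = p \<longleftrightarrow> is_arg_min (\<lambda>y. \<phi> (x - y)) (\<lambda>y. y \<in> C) p"
    using ex1 by blast
  then show ?thesis
    by (auto simp: is_arg_min_linorder)
qed

lemma phi_projection_residual:
  fixes \<phi> :: "'a::real_vector \<Rightarrow> real"
  assumes proj: "has_phi_projection \<phi> C"
    and "0 \<in> C"
    and add: "\<And>u v. u \<in> C \<Longrightarrow> v \<in> C \<Longrightarrow> u + v \<in> C"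
  shows "phi_projection \<phi> C (x - phi_projection \<phi> C x) = 0"
proof -
  define p where "p = phi_projection \<phi> C x"
  have p: "p \<in> C" "\<And>y. y \<in> C \<Longrightarrow> \<phi> (x - p) \<le> \<phi> (x - y)"
    using phi_projection_eq_iff[OF proj] p_def by metis+
  have "\<phi> (x - p - 0) \<le> \<phi> (x - p - y)" if "y \<in> C" for y
    using p(2)[OF add[OF p(1) that]] by (simp add: diff_diff_eq)
  then show ?thesis
    using \<open>0 \<in> C\<close> phi_projection_eq_iff[OF proj] unfolding p_def by blast
qed

theorem theorem1:
  fixes \<phi> :: "real ^ 'n \<Rightarrow> real"
    and C :: "(real ^ 'n) set"
    and P :: "real ^ 'n \<Rightarrow> real ^ 'n"
  assumes "strongly_quasiconvex \<phi>"
    and "continuous_on UNIV \<phi>"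
    and "\<And>x. 0 \<le> \<phi> x"
    and "\<phi> 0 = 0"
    and "closed C"
    and "convex_cone C"
    and "has_phi_projection \<phi> C"
    and "P = phi_projection \<phi> C"
  shows "(\<forall>x. P (x - P x) = 0) \<and> range (\<lambda>x. x - P x) = {x. P x = 0}"
proof -
  have residual: "P (x - P x) = 0" for x
    unfolding \<open>P = phi_projection \<phi> C\<close>
    using assms(7) convex_cone_contains_0[OF \<open>convex_cone C\<close>] convex_cone_add[OF \<open>convex_cone C\<close>]
    by (rule phi_projection_residual)
  have "x \<in> range (\<lambda>x. x - P x)" if "P x = 0" for x
    using that by (intro image_eqI[where x = x]) auto
  with residual show ?thesis
    by auto
qed

end
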